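(* The map $\Lambda_{\mathrm{gr}}:\mathcal G(A)\to G^1$, $\Lambda_{\mathrm{gr}}(\phi)=\phi(\mathbf 1)+\sum_{w\in\mathbb N^*}\phi(w)x_w$, defines a group isomorphism between the group $(\mathcal G(A),\ast)$ and the group $(G^1,\bullet)$.
   Context: $\mathbb K$ is a field of characteristic zero, $A$ a commutative unital $\mathbb K$-algebra, $\mathbb N=\{1,2,\dots\}$, $\mathbb N^*$ the set of non-empty finite words over $\mathbb N$, $\mathbf 1$ the empty word. Series side. $R=A\langle\langle x_1,x_2,\dots\rangle\rangle$ is the ring of non-commutative formal power series $f=\sum_{w\in\mathbb N^*\cup\{\mathbf 1\}}f_wx_w$ ($f_w\in A$ arbitrary, $x_w=x_{i_1}\cdots x_{i_m}$ for $w=i_1\cdots i_m$, $x_{\mathbf 1}=1_A$). $G^1=\{f\in R:f_{\mathbf 1}=1_A\}$ is a group for the shifted composition $(f\bullet g)(x)=g(x)f(xg(x))$, where $f(xg(x))$ is obtained from $f$ by substituting $x_ig(x)$ for each $x_i$. Hopf algebra side. $V$ is the $\mathbb K$-vector space with basis $\mathbb N^*$, and $T(V)=\bigoplus_{n\ge0}V^{\otimes n}$ is its tensor algebra, with unit $\mathbf 1$ (identified with the empty word) and product written with bars, $w_1|\cdots|w_k$. For a word $w=a_1\cdots a_n\in\mathbb N^*$ and $S=\{i_1<\dots<i_k\}\subseteq[n]=\{1,\dots,n\}$ put $w_S=a_{i_1}\cdots a_{i_k}$ ($w_\varnothing=\mathbf 1$), and let $J_1^S,\dots,J_m^S$ be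 the maximal intervals (of consecutive integers) of $[n]\setminus S$, in increasing order. The coproduct is the algebra morphism $\Delta:T(V)\to T(V)\otimes T(V)$ with $\Delta(w)=\sum_{S\subseteq[n]}w_S\otimes w_{J_1^S}|\cdots|w_{J_m^S}$. With it, $T(V)$ is a graded connected Hopf algebra. $\mathcal G(A)$ is the set of unital algebra morphisms $T(V)\to A$, a group under the convolution product $\phi\ast\psi=m_A(\phi\otimes\psi)\Delta$, where $m_A$ is the product of $A$. *)

theory Defs
  imports
    Complex_Main
    "HOL-Library.Poly_Mapping"
    "HOL-Library.Product_Plus"
    "HOL-Algebra.Group"
begin

section \<open>Algebras over a field\<close>

text \<open>The sort of \<open>'a\<close> is that of commutative unital rings in which \<open>0 = 1\<close> is allowed
  (unlike in \<^class>\<open>comm_ring_1\<close>), so that the zero algebra is included.\<close>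

locale comm_unital_algebra = vector_space scale
  for scale :: "'k::field \<Rightarrow> 'a::{comm_ring, comm_monoid_mult} \<Rightarrow> 'a" +
  assumes scale_mult_left: "scale c (x * y) = scale c x * y"


section \<open>Words\<close>

typedef pnat = "{n :: nat. 1 \<le> n}"
  by auto

typedef nonempty_word = "{w :: pnat list. w \<noteq> []}"
  by auto


section \<open>Formal power series in non-commuting variables\<close>

text \<open>A series is its family of coefficients \<open>w \<mapsto> f\<^sub>w\<close>, with \<open>[]\<close> the empty word.\<close>

type_synonym 'a series = "pnat list \<Rightarrow> 'a"

definition series_one :: "'a::{comm_ring, comm_monoid_mult} series" where
  "series_one w = (if w = [] then 1 else 0)"

definition series_var :: "pnat \<Rightarrow> 'a::{comm_ring, comm_monoid_mult} series" where
  "series_var i w = (if w = [i] then 1 else 0)"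

definition series_mult ::
    "'a::{comm_ring, comm_monoid_mult} series \<Rightarrow> 'a series \<Rightarrow> 'a series" where
  "series_mult f g w = (\<Sum>i\<le>length w. f (take i w) * g (drop i w))"

definition series_prod_list :: "'a::{comm_ring, comm_monoid_mult} series list \<Rightarrow> 'a series" where
  "series_prod_list fs = foldr series_mult fs series_one"

text \<open>\<open>series_subst h f\<close> is obtained from \<open>f\<close> by substituting \<open>h i\<close> for each \<open>x\<^sub>i\<close>, that is
  \<open>\<Sum>\<^sub>u f\<^sub>u h\<^bsub>u\<^sub>1\<^esub> \<cdots> h\<^bsub>u\<^sub>k\<^esub>\<close>. The sum defining a coefficient has to have finite support, otherwise
  \<^const>\<open>Sum_any\<close> is \<open>0\<close>; for \<open>h i = x\<^sub>i g\<close> this is the lemma \<open>finite_support_series_subst\<close> below.\<close>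

definition series_subst ::
    "(pnat \<Rightarrow> 'a::{comm_ring, comm_monoid_mult} series) \<Rightarrow> 'a series \<Rightarrow> 'a series" where
  "series_subst h f w = Sum_any (\<lambda>u. f u * series_prod_list (map h u) w)"

lemma series_prod_list_shift_nonzero:
  fixes g :: "'a::{comm_ring, comm_monoid_mult} series"
  assumes "series_prod_list (map (\<lambda>i. series_mult (series_var i) g) u) w \<noteq> 0"
  shows "set u \<subseteq> set w \<and> length u \<le> length w"
  using assms
proof (induction u arbitrary: w)
  case (Cons i u)
  let ?h = "\<lambda>i. series_mult (series_var i) g"
  have "series_mult (?h i) (series_prod_list (map ?h u)) w \<noteq> 0"
    using Cons.prems by (simp add: series_prod_list_def)
  then obtain k where "k \<le> length w"
    and k: "?h i (take k w) * series_prod_list (map ?h u) (drop k w) \<noteq> 0"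
    unfolding series_mult_def[of "series_mult _ _"] by (meson atMost_iff sum.neutral)
  then have a: "?h i (take k w) \<noteq> 0" and b: "series_prod_list (map ?h u) (drop k w) \<noteq> 0"
    by auto
  from a obtain j where "series_var i (take j (take k w)) * g (drop j (take k w)) \<noteq> 0"
    unfolding series_mult_def by (meson sum.neutral)
  then have j: "take j (take k w) = [i]"
    by (auto simp: series_var_def split: if_splits)
  have "i \<in> set (take k w)"
    using j by (metis in_set_takeD list.set_intros(1))
  moreover have "k \<noteq> 0"
    using j by (metis list.distinct(1) take_0 take_Nil)
  ultimately have "i \<in> set w" "length (drop k w) < length w"
    using \<open>k \<le> length w\<close> by (fastforce dest: in_set_takeD)+
  moreover have "set u \<subseteq> set (drop k w) \<and> length u \<le> length (drop k w)"
    using Cons.IH b by blast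
  ultimately show ?case
    using set_drop_subset[of k w] by auto
qed simp

lemma finite_support_series_subst:
  fixes f g :: "'a::{comm_ring, comm_monoid_mult} series"
  shows "finite {u. f u * series_prod_list (map (\<lambda>i. series_mult (series_var i) g) u) w \<noteq> 0}"
proof (rule finite_subset)
  show "finite {u. set u \<subseteq> set w \<and> length u \<le> length w}"
    by (rule finite_lists_length_le) simp
  show "{u. f u * series_prod_list (map (\<lambda>i. series_mult (series_var i) g) u) w \<noteq> 0}
      \<subseteq> {u. set u \<subseteq> set w \<and> length u \<le> length w}"
  proof (rule subsetI)
    fix u
    assume "u \<in> {u. f u * series_prod_list (map (\<lambda>i. series_mult (series_var i) g) u) w \<noteq> 0}"
    then have "series_prod_list (map (\<lambda>i. series_mult (series_var i) g) u) w \<noteq> 0"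
      by (metis (mono_tags, lifting) mem_Collect_eq mult_zero_right)
    then show "u \<in> {u. set u \<subseteq> set w \<and> length u \<le> length w}"
      using series_prod_list_shift_nonzero by blast
  qed
qed

text \<open>\<open>(f \<bullet> g)(x) = g(x) f(x g(x))\<close>\<close>

definition shifted_comp ::
    "'a::{comm_ring, comm_monoid_mult} series \<Rightarrow> 'a series \<Rightarrow> 'a series" where
  "shifted_comp f g = series_mult g (series_subst (\<lambda>i. series_mult (series_var i) g) f)"

definition series_group :: "'a::{comm_ring, comm_monoid_mult} series monoid" where
  "series_group = \<lparr>carrier = {f. f [] = 1}, mult = shifted_comp, one = series_one\<rparr>"


section \<open>The tensor algebra\<close>

text \<open>The words \<open>w\<^sub>1|\<cdots>|w\<^sub>k\<close> in non-empty words form the free monoid on the basis of \<open>V\<close>,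
  written additively because \<^typ>\<open>'b \<Rightarrow>\<^sub>0 'k\<close> carries the product of the monoid algebra of an
  additive (not necessarily commutative) monoid \<^typ>\<open>'b\<close>. The monoid algebra of \<open>bar_word\<close> is
  \<open>T(V)\<close>, and \<open>T(V) \<otimes> T(V)\<close>, with the componentwise product, is the monoid algebra of
  \<open>bar_word \<times> bar_word\<close>.\<close>

datatype bar_word = Bars (blocks: "nonempty_word list")

instantiation bar_word :: monoid_add
begin

definition zero_bar_word :: bar_word where
  "0 = Bars []"

definition plus_bar_word :: "bar_word \<Rightarrow> bar_word \<Rightarrow> bar_word" where
  "u + v = Bars (blocks u @ blocks v)"

instance
  by standard (simp_all add: zero_bar_word_def plus_bar_word_def)

end

type_synonym 'k tensor_alg = "bar_word \<Rightarrow>\<^sub>0 'k"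
type_synonym 'k tensor_alg2 = "bar_word \<times> bar_word \<Rightarrow>\<^sub>0 'k"

definition pm_scale :: "'k::field \<Rightarrow> ('b \<Rightarrow>\<^sub>0 'k) \<Rightarrow> ('b \<Rightarrow>\<^sub>0 'k)" where
  "pm_scale c = Poly_Mapping.map ((*) c)"

text \<open>The linear map with prescribed values \<open>h\<close> on the basis, into a space with scalar
  multiplication \<open>s\<close>.\<close>

definition linear_ext :: "('k::field \<Rightarrow> 'c::ab_group_add \<Rightarrow> 'c) \<Rightarrow> ('b \<Rightarrow> 'c) \<Rightarrow> ('b \<Rightarrow>\<^sub>0 'k) \<Rightarrow> 'c"
  where "linear_ext s h x = (\<Sum>b\<in>Poly_Mapping.keys x. s (Poly_Mapping.lookup x b) (h b))"

definition tensor :: "'k::field tensor_alg \<Rightarrow> 'k tensor_alg \<Rightarrow> 'k tensor_alg2" where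
  "tensor x y = (\<Sum>u\<in>Poly_Mapping.keys x. \<Sum>v\<in>Poly_Mapping.keys y.
     Poly_Mapping.single (u, v) (Poly_Mapping.lookup x u * Poly_Mapping.lookup y v))"

text \<open>The empty word is identified with the unit of \<open>T(V)\<close>.\<close>

definition of_word :: "pnat list \<Rightarrow> 'k::field tensor_alg" where
  "of_word w = (if w = [] then 1 else Poly_Mapping.single (Bars [Abs_nonempty_word w]) 1)"


section \<open>The coproduct\<close>

text \<open>Positions in a word are counted from \<open>0\<close>, as in \<^const>\<open>nths\<close>; so \<open>[n]\<close> becomes
  \<open>{..<n}\<close>.\<close>

definition max_intervals :: "nat set \<Rightarrow> nat set set" where
  "max_intervals U = {J. J \<noteq> {} \<and> (\<exists>a b. J = {a..b}) \<and> J \<subseteq> U \<and>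
     (\<forall>a b. J \<subseteq> {a..b} \<and> {a..b} \<subseteq> U \<longrightarrow> {a..b} = J)}"

definition complement_intervals :: "nat \<Rightarrow> nat set \<Rightarrow> nat set list" where
  "complement_intervals n S = sorted_key_list_of_set Min (max_intervals ({..<n} - S))"

definition coproduct_word :: "pnat list \<Rightarrow> 'k::field tensor_alg2" where
  "coproduct_word w = (\<Sum>S\<in>Pow {..<length w}.
     tensor (of_word (nths w S))
       (prod_list (map (\<lambda>J. of_word (nths w J)) (complement_intervals (length w) S))))"

definition coproduct :: "'k::field tensor_alg \<Rightarrow> 'k tensor_alg2" where
  "coproduct = linear_ext pm_scale
     (\<lambda>u. prod_list (map (\<lambda>w. coproduct_word (Rep_nonempty_word w)) (blocks u)))"


section \<open>The group of characters\<close>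

definition characters ::
    "('k::field \<Rightarrow> 'a::{comm_ring, comm_monoid_mult} \<Rightarrow> 'a) \<Rightarrow> ('k tensor_alg \<Rightarrow> 'a) set" where
  "characters scale =
     {\<phi>. Vector_Spaces.linear pm_scale scale \<phi> \<and> \<phi> 1 = 1 \<and> (\<forall>x y. \<phi> (x * y) = \<phi> x * \<phi> y)}"

text \<open>\<open>m\<^sub>A \<circ> (\<phi> \<otimes> \<psi>)\<close>, i.e. the linear map \<open>T(V) \<otimes> T(V) \<rightarrow> A\<close>
  with \<open>x \<otimes> y \<mapsto> \<phi>(x) \<psi>(y)\<close>.\<close>

definition mult_tensor_map ::
    "('k::field \<Rightarrow> 'a::{comm_ring, comm_monoid_mult} \<Rightarrow> 'a) \<Rightarrow>
      ('k tensor_alg \<Rightarrow> 'a) \<Rightarrow> ('k tensor_alg \<Rightarrow> 'a) \<Rightarrow> 'k tensor_alg2 \<Rightarrow> 'a" where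
  "mult_tensor_map scale \<phi> \<psi> = linear_ext scale
     (\<lambda>(u, v). \<phi> (Poly_Mapping.single u 1) * \<psi> (Poly_Mapping.single v 1))"

definition convolution ::
    "('k::field \<Rightarrow> 'a::{comm_ring, comm_monoid_mult} \<Rightarrow> 'a) \<Rightarrow>
      ('k tensor_alg \<Rightarrow> 'a) \<Rightarrow> ('k tensor_alg \<Rightarrow> 'a) \<Rightarrow> 'k tensor_alg \<Rightarrow> 'a" where
  "convolution scale \<phi> \<psi> = mult_tensor_map scale \<phi> \<psi> \<circ> coproduct"

text \<open>The unit is the counit (projection onto \<open>V\<^sup>\<otimes>\<^sup>0\<close>) followed by the unit map of \<open>A\<close>.\<close>

definition character_group ::
    "('k::field \<Rightarrow> 'a::{comm_ring, comm_monoid_mult} \<Rightarrow> 'a) \<Rightarrow> ('k tensor_alg \<Rightarrow> 'a) monoid" where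
  "character_group scale =
     \<lparr>carrier = characters scale,
      mult = convolution scale,
      one = (\<lambda>x. scale (Poly_Mapping.lookup x 0) 1)\<rparr>"

definition Lambda_gr ::
    "('k::field tensor_alg \<Rightarrow> 'a::{comm_ring, comm_monoid_mult}) \<Rightarrow> 'a series" where
  "Lambda_gr \<phi> = (\<lambda>w. \<phi> (of_word w))"


section \<open>The maps above have their defining properties\<close>

lemma lookup_pm_scale: "Poly_Mapping.lookup (pm_scale c x) b = c * Poly_Mapping.lookup x b"
  by (simp add: pm_scale_def map.rep_eq when_def)

lemma vector_space_pm_scale: "vector_space (pm_scale :: 'k::field \<Rightarrow> ('b \<Rightarrow>\<^sub>0 'k) \<Rightarrow> _)"
  by standard (auto intro!: poly_mapping_eqI simp: lookup_pm_scale lookup_add algebra_simps)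

lemma linear_ext_superset:
  assumes "vector_space s" "finite B" "Poly_Mapping.keys x \<subseteq> B"
  shows "linear_ext s h x = (\<Sum>b\<in>B. s (Poly_Mapping.lookup x b) (h b))"
proof -
  interpret vector_space s by fact
  show ?thesis
    unfolding linear_ext_def using assms(2,3)
    by (intro sum.mono_neutral_left) (auto simp: in_keys_iff)
qed

lemma linear_linear_ext:
  assumes "vector_space s"
  shows "Vector_Spaces.linear pm_scale s (linear_ext s h)"
proof -
  interpret S: vector_space s by fact
  interpret P: vector_space "pm_scale :: 'a \<Rightarrow> ('c \<Rightarrow>\<^sub>0 'a) \<Rightarrow> _" by (rule vector_space_pm_scale)
  show ?thesis
  proof (unfold_locales)
    fix x y :: "'c \<Rightarrow>\<^sub>0 'a" and c
    let ?B = "Poly_Mapping.keys x \<union> Poly_Mapping.keys y"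
    have "Poly_Mapping.keys (x + y) \<subseteq> ?B" by (rule keys_add)
    then show "linear_ext s h (x + y) = linear_ext s h x + linear_ext s h y"
      by (simp add: linear_ext_superset[OF assms, of ?B] lookup_add S.scale_left_distrib sum.distrib)
    have "Poly_Mapping.keys (pm_scale c x) \<subseteq> Poly_Mapping.keys x"
      by (auto simp: in_keys_iff lookup_pm_scale)
    then show "linear_ext s h (pm_scale c x) = s c (linear_ext s h x)"
      by (simp add: linear_ext_superset[OF assms, of "Poly_Mapping.keys x"] lookup_pm_scale
          S.scale_sum_right)
  qed
qed

lemma linear_ext_single:
  assumes "vector_space s"
  shows "linear_ext s h (Poly_Mapping.single b c) = s c (h b)"
proof -
  interpret vector_space s by fact
  show ?thesis by (simp add: linear_ext_def)
qed

lemma pm_expand: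
  "x = (\<Sum>b\<in>Poly_Mapping.keys x. Poly_Mapping.single b (Poly_Mapping.lookup x b))"
  by (rule poly_mapping_eqI) (auto simp: lookup_sum lookup_single when_def in_keys_iff)

lemma pm_scale_single: "pm_scale c (Poly_Mapping.single b d) = Poly_Mapping.single b (c * d)"
  by (simp add: pm_scale_def)

lemma pm_scale_mult:
  fixes x y :: "'b::monoid_add \<Rightarrow>\<^sub>0 'k::field"
  shows "pm_scale c x * y = pm_scale c (x * y)" "x * pm_scale c y = pm_scale c (x * y)"
proof -
  have e: "pm_scale c z = Poly_Mapping.single 0 c * z" for z :: "'b \<Rightarrow>\<^sub>0 'k"
    by (simp add: pm_scale_def mult_map_scale_conv_mult)
  have "x * Poly_Mapping.single 0 c = Poly_Mapping.single 0 c * x"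
    by (subst (1 2) pm_expand[of x])
      (simp add: sum_distrib_left sum_distrib_right mult_single mult.commute)
  then show "pm_scale c x * y = pm_scale c (x * y)" "x * pm_scale c y = pm_scale c (x * y)"
    unfolding e by (metis mult.assoc)+
qed

lemma max_intervals_disjoint:
  assumes "J \<in> max_intervals U" "K \<in> max_intervals U" "x \<in> J" "x \<in> K"
  shows "J = K"
proof -
  obtain a b c d where J: "J = {a..b}" and K: "K = {c..d}"
    using assms(1,2) by (auto simp: max_intervals_def)
  let ?L = "{min a c..max b d}"
  have "?L \<subseteq> J \<union> K"
    using assms(3,4) unfolding J K by auto
  moreover have "J \<subseteq> U" "K \<subseteq> U"
    using assms(1,2) by (auto simp: max_intervals_def)
  ultimately have "?L \<subseteq> U" by blast
  moreover have "J \<subseteq> ?L" "K \<subseteq> ?L"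
    unfolding J K by auto
  ultimately have "?L = J" "?L = K"
    using assms(1,2) unfolding max_intervals_def by blast+
  then show ?thesis by simp
qed

lemma (in linorder) sorted_key_list_of_set_inj_on:
  assumes "inj_on f M" "finite M"
  shows "set (sorted_key_list_of_set f M) = M"
    and "sorted_wrt (<) (map f (sorted_key_list_of_set f M))"
proof -
  interpret I: folding_insort_key "(\<le>)" "(<)" M f
    by unfold_locales (rule assms(1))
  show "set (sorted_key_list_of_set f M) = M"
    using assms(2) by (rule I.set_sorted_key_list_of_set[OF subset_refl])
  show "sorted_wrt (<) (map f (sorted_key_list_of_set f M))"
    by (rule I.strict_sorted_key_list_of_set[OF subset_refl])
qed

lemma complement_intervals:
  shows "set (complement_intervals n S) = max_intervals ({..<n} - S)"
    and "sorted_wrt (<) (map Min (complement_intervals n S))"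
proof -
  let ?M = "max_intervals ({..<n} - S)"
  have sub: "?M \<subseteq> Pow {..<n}"
    by (auto simp: max_intervals_def)
  then have fin: "finite ?M"
    by (rule finite_subset) simp
  have "Min J \<in> J" if "J \<in> ?M" for J
    using that sub by (intro Min_in) (auto simp: max_intervals_def intro: finite_subset)
  then have inj: "inj_on Min ?M"
    by (intro inj_onI) (metis max_intervals_disjoint)
  show "set (complement_intervals n S) = ?M"
    and "sorted_wrt (<) (map Min (complement_intervals n S))"
    unfolding complement_intervals_def using inj fin by (rule sorted_key_list_of_set_inj_on)+
qed

lemma coproduct_linear: "Vector_Spaces.linear pm_scale pm_scale coproduct"
  unfolding coproduct_def by (intro linear_linear_ext vector_space_pm_scale)

lemma coproduct_single:
  "coproduct (Poly_Mapping.single u c) =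
    pm_scale c (prod_list (map (\<lambda>w. coproduct_word (Rep_nonempty_word w)) (blocks u)))"
  by (simp add: coproduct_def linear_ext_single[OF vector_space_pm_scale])

lemma coproduct_one: "coproduct (1 :: 'k::field tensor_alg) = 1"
  unfolding single_one[symmetric] coproduct_single
  by (simp add: zero_bar_word_def zero_prod_def pm_scale_single flip: single_one)

lemma coproduct_mult: "coproduct (x * y) = coproduct x * coproduct y"
proof -
  interpret P: vector_space "pm_scale :: 'a \<Rightarrow> 'a tensor_alg2 \<Rightarrow> _"
    by (rule vector_space_pm_scale)
  interpret C: Vector_Spaces.linear pm_scale pm_scale "coproduct :: 'a tensor_alg \<Rightarrow> _"
    by (rule coproduct_linear)
  have *: "coproduct (Poly_Mapping.single u c * Poly_Mapping.single v d)
      = coproduct (Poly_Mapping.single u c) * coproduct (Poly_Mapping.single v d)"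
    for u v and c d :: 'a
    by (simp add: mult_single coproduct_single plus_bar_word_def pm_scale_mult)
  show ?thesis
    by (subst (1 2) pm_expand[of x], subst (1 2) pm_expand[of y])
      (simp add: sum_distrib_left sum_distrib_right C.sum *)
qed

lemma coproduct_of_word:
  assumes "w \<noteq> []"
  shows "coproduct (of_word w) = coproduct_word w"
  using assms
  by (simp add: of_word_def coproduct_single Abs_nonempty_word_inverse pm_scale_def
      mult_map_scale_conv_mult)

lemma mult_tensor_map_tensor:
  assumes "comm_unital_algebra scale"
    and "Vector_Spaces.linear pm_scale scale \<phi>" "Vector_Spaces.linear pm_scale scale \<psi>"
  shows "mult_tensor_map scale \<phi> \<psi> (tensor x y) = \<phi> x * \<psi> y"
proof -
  interpret A: comm_unital_algebra scale by fact
  interpret phi: Vector_Spaces.linear pm_scale scale \<phi> by fact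
  interpret psi: Vector_Spaces.linear pm_scale scale \<psi> by fact
  have lin: "Vector_Spaces.linear pm_scale scale (mult_tensor_map scale \<phi> \<psi>)"
    unfolding mult_tensor_map_def by (intro linear_linear_ext A.vector_space_axioms)
  interpret M: Vector_Spaces.linear pm_scale scale "mult_tensor_map scale \<phi> \<psi>"
    by (rule lin)
  have right: "scale c (a * b) = a * scale c b" for a b c
    using A.scale_mult_left[of c b a] by (simp add: mult.commute)
  have p: "\<phi> (Poly_Mapping.single u c) = scale c (\<phi> (Poly_Mapping.single u 1))" for u c
    using phi.scale[of c "Poly_Mapping.single u 1"] by (simp add: pm_scale_single)
  have q: "\<psi> (Poly_Mapping.single u c) = scale c (\<psi> (Poly_Mapping.single u 1))" for u c
    using psi.scale[of c "Poly_Mapping.single u 1"] by (simp add: pm_scale_single)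
  have *: "mult_tensor_map scale \<phi> \<psi> (Poly_Mapping.single (u, v) (c * d))
      = \<phi> (Poly_Mapping.single u c) * \<psi> (Poly_Mapping.single v d)" for u v c d
    unfolding p[of u c] q[of v d] mult_tensor_map_def
    by (simp add: linear_ext_single[OF A.vector_space_axioms] right flip: A.scale_mult_left A.scale_scale)
  have "mult_tensor_map scale \<phi> \<psi> (tensor x y) =
      (\<Sum>u\<in>Poly_Mapping.keys x. \<phi> (Poly_Mapping.single u (Poly_Mapping.lookup x u))) *
      (\<Sum>v\<in>Poly_Mapping.keys y. \<psi> (Poly_Mapping.single v (Poly_Mapping.lookup y v)))"
    by (simp add: tensor_def M.sum * sum_product)
  also have "\<dots> = \<phi> x * \<psi> y"
    by (subst (3) pm_expand[of x], subst (3) pm_expand[of y]) (simp add: phi.sum psi.sum)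
  finally show ?thesis .
qed

end

theory Submission
  imports Defs
begin

text \<open>Write \<open>T\<^sub>g f = f(x g(x))\<close> and \<open>\<partial>\<^sub>i f\<close> for the series with coefficients \<open>w \<mapsto> f\<^bsub>iw\<^esub>\<close>. Then
  \<open>\<partial>\<^sub>i (T\<^sub>g f) = g \<cdot> T\<^sub>g (\<partial>\<^sub>i f)\<close>, and with the twisted Leibniz rule
  \<open>\<partial>\<^sub>i (a b) = \<partial>\<^sub>i a \<cdot> b + a\<^sub>\<one> \<partial>\<^sub>i b\<close> all identities between series are proved by induction
  on the length of the word: \<open>T\<^sub>g\<close> is multiplicative, \<open>T\<^sub>h T\<^sub>g = T\<^bsub>h T\<^sub>h g\<^esub>\<close> (which is
  associativity of \<open>\<bullet>\<close>), and \<open>T\<^sub>g y = g\<^sup>-\<^sup>1\<close> is solvable (which gives the inverses).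
  Splitting a subset \<open>S\<close> of the positions of \<open>w\<close> at its least element shows that the coefficients
  of the convolution satisfy the same recursion as \<open>g \<cdot> T\<^sub>g f\<close>, so \<open>\<Lambda>\<close> is
  multiplicative. As \<open>T(V)\<close> is free, \<open>\<Lambda>\<close> is a bijection, and the group axioms are
  transported along it to the characters.\<close>

section \<open>The product of series\<close>

lemma series_mult_Nil [simp]: "series_mult a b [] = a [] * b []"
  by (simp add: series_mult_def)

text \<open>The twisted Leibniz rule: the cut before \<open>i\<close> gives the last term, every
  other cut leaves \<open>i\<close> in the left factor.\<close>

lemma series_mult_Cons:
  "series_mult a b (i # w) = series_mult (\<lambda>u. a (i # u)) b w + a [] * b (i # w)"
  by (simp add: series_mult_def sum.atMost_Suc_shift add.commute del: sum.atMost_Suc)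

text \<open>Lets induction hypotheses on the length of the word be used under
  \<open>series_mult\<close>.\<close>

lemma series_mult_cong:
  assumes "\<And>v. length v \<le> length w \<Longrightarrow> a v = a' v" "\<And>v. length v \<le> length w \<Longrightarrow> b v = b' v"
  shows "series_mult a b w = series_mult a' b' w"
  unfolding series_mult_def using assms by (intro sum.cong) auto

lemma series_mult_add_left:
  "series_mult (\<lambda>u. a u + b u) c w = series_mult a c w + series_mult b c w"
  by (simp add: series_mult_def distrib_right sum.distrib)

lemma series_mult_add_right:
  "series_mult c (\<lambda>u. a u + b u) w = series_mult c a w + series_mult c b w"
  by (simp add: series_mult_def distrib_left sum.distrib)

lemma series_mult_scale_left: "series_mult (\<lambda>u. s * a u) b w = s * series_mult a b w"
  by (simp add: series_mult_def sum_distrib_left mult.assoc)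

lemma series_mult_scale_right: "series_mult b (\<lambda>u. s * a u) w = s * series_mult b a w"
  by (simp add: series_mult_def sum_distrib_left mult.left_commute)

lemma series_mult_zero_left [simp]: "series_mult (\<lambda>u. 0) b w = 0"
  by (simp add: series_mult_def)

lemma series_mult_one_left [simp]: "series_mult series_one b = b"
proof
  fix w
  show "series_mult series_one b w = b w"
    by (cases w) (simp_all add: series_mult_Cons series_one_def)
qed

lemma series_mult_one_right [simp]: "series_mult b series_one = b"
proof
  fix w
  show "series_mult b series_one w = b w"
    by (induction w arbitrary: b) (simp_all add: series_mult_Cons series_one_def[of "_ # _"],
      simp add: series_one_def)
qed

lemma series_mult_assoc: "series_mult (series_mult a b) c = series_mult a (series_mult b c)"
proof
  fix w
  show "series_mult (series_mult a b) c w = series_mult a (series_mult b c) w"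
    by (induction w arbitrary: a)
      (simp_all add: series_mult_Cons series_mult_add_left series_mult_scale_left
        distrib_left mult.assoc add.assoc)
qed

text \<open>The equation for the coefficient of \<open>i # w\<close> in \<open>g y = 1\<close>,
  solved for \<open>y (i # w)\<close> in the case \<open>g [] = 1\<close>.\<close>

function series_inverse :: "'a::{comm_ring, comm_monoid_mult} series \<Rightarrow> 'a series" where
  "series_inverse g [] = 1"
| "series_inverse g (i # w) = - (\<Sum>k\<le>length w. g (i # take k w) * series_inverse g (drop k w))"
  by pat_completeness auto
termination
  by (relation "measure (length \<circ> snd)") auto

lemma series_mult_inverse:
  assumes "g [] = 1"
  shows "series_mult g (series_inverse g) = series_one"
proof
  fix w
  show "series_mult g (series_inverse g) w = series_one w"
    using assms
    by (cases w) (simp_all add: series_one_def series_mult_Cons, simp add: series_mult_def)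
qed


section \<open>The substitution of \<open>x\<^sub>i g(x)\<close> for \<open>x\<^sub>i\<close>\<close>

text \<open>The operator \<open>T\<^sub>g\<close>.\<close>

definition series_shift ::
    "'a::{comm_ring, comm_monoid_mult} series \<Rightarrow> 'a series \<Rightarrow> 'a series" where
  "series_shift g = series_subst (\<lambda>i. series_mult (series_var i) g)"

lemma shifted_comp_eq: "shifted_comp f g = series_mult g (series_shift g f)"
  by (simp add: shifted_comp_def series_shift_def)

lemma series_prod_list_shift_Cons:
  "series_prod_list (map (\<lambda>i. series_mult (series_var i) g) (j # u)) w =
    (case w of [] \<Rightarrow> 0 | i # w' \<Rightarrow> if i = j
      then series_mult g (series_prod_list (map (\<lambda>i. series_mult (series_var i) g) u)) w' else 0)"
proof -
  have "(\<lambda>u. series_var j (i # u)) = (if i = j then series_one else (\<lambda>u. 0 :: 'a))" for i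
    by (auto simp: series_var_def series_one_def fun_eq_iff)
  then show ?thesis
    by (auto simp: series_prod_list_def series_mult_assoc series_mult_Cons series_var_def[of _ "[]"]
        split: list.split)
qed

lemma series_shift_Nil [simp]: "series_shift g f [] = f []"
proof -
  let ?P = "\<lambda>u. series_prod_list (map (\<lambda>i. series_mult (series_var i) g) u) []"
  have "?P u = 0" if "u \<noteq> []" for u
    using that by (cases u) (simp_all add: series_prod_list_shift_Cons del: list.map)
  then have "{u. f u * ?P u \<noteq> 0} \<subseteq> {[]}"
    by fastforce
  then have "series_shift g f [] = (\<Sum>u\<in>{[]}. f u * ?P u)"
    unfolding series_shift_def series_subst_def by (intro Sum_any.expand_superset) auto
  then show ?thesis
    by (simp add: series_prod_list_def series_one_def)
qed

text \<open>Only the monomials of \<open>f\<close> that begin with \<open>i\<close> contribute,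
  since \<open>x\<^sub>j g\<close> starts with \<open>x\<^sub>j\<close>; removing the letter
  \<open>i\<close> from \<open>x\<^sub>i g\<close> leaves the factor \<open>g\<close>.\<close>

lemma series_shift_Cons:
  "series_shift g f (i # w) = series_mult g (series_shift g (\<lambda>u. f (i # u))) w"
proof -
  let ?P = "\<lambda>u. series_prod_list (map (\<lambda>i. series_mult (series_var i) g) u)"
  \<comment> \<open>\<open>B\<close> contains the supports of the sums at all suffixes of
    \<open>w\<close>, so one finite index set serves them all and the summations can be
    exchanged.\<close>
  define B where "B = {u. set u \<subseteq> set w \<and> length u \<le> length w}"
  have fin: "finite B"
    unfolding B_def by (rule finite_lists_length_le) simp
  have sub: "u \<in> B" if "?P u (drop k w) \<noteq> 0" for u k
    using series_prod_list_shift_nonzero[OF that] set_drop_subset[of k w] by (auto simp: B_def)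
  have tail: "series_shift g (\<lambda>u. f (i # u)) (drop k w) = (\<Sum>u\<in>B. f (i # u) * ?P u (drop k w))"
    for k
    unfolding series_shift_def series_subst_def using fin
    by (intro Sum_any.expand_superset) (auto intro!: sub[of _ k])
  have "u \<in> (#) i ` B \<union> {[]}" if "f u * ?P u (i # w) \<noteq> 0" for u
  proof (cases u)
    case (Cons j v)
    have *: "?P u (i # w) \<noteq> 0"
      using that by auto
    then have "j = i" "series_mult g (?P v) w \<noteq> 0"
      unfolding Cons series_prod_list_shift_Cons by (auto split: if_splits)
    then obtain k where "g (take k w) * ?P v (drop k w) \<noteq> 0"
      unfolding series_mult_def[of g] by (meson sum.neutral)
    then have "v \<in> B"
      by (intro sub[of v k]) auto
    then show ?thesis
      using Cons \<open>j = i\<close> by simp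
  qed simp
  then have "series_shift g f (i # w) = (\<Sum>u\<in>(#) i ` B \<union> {[]}. f u * ?P u (i # w))"
    unfolding series_shift_def series_subst_def using fin
    by (intro Sum_any.expand_superset) auto
  also have "\<dots> = (\<Sum>u\<in>(#) i ` B. f u * ?P u (i # w))"
    using fin by (subst sum.union_disjoint) (auto simp: series_prod_list_def series_one_def)
  also have "\<dots> = (\<Sum>u\<in>B. f (i # u) * series_mult g (?P u) w)"
    by (subst sum.reindex) (simp_all add: series_prod_list_shift_Cons del: list.map)
  also have "\<dots> = series_mult g (series_shift g (\<lambda>u. f (i # u))) w"
    unfolding series_mult_def[of g] tail
    by (simp add: sum_distrib_left mult.left_commute, rule sum.swap)
  finally show ?thesis .
qed

section \<open>Algebraic laws of the substitution operator\<close>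

lemma series_shift_one [simp]: "series_shift g series_one = series_one"
proof
  fix w
  have zero: "series_shift g (\<lambda>u. 0) = (\<lambda>u. 0)"
    by (simp add: series_shift_def series_subst_def fun_eq_iff)
  show "series_shift g series_one w = series_one w"
    by (cases w) (simp_all add: series_shift_Cons series_one_def zero, simp add: series_mult_def)
qed

lemma series_shift_by_one [simp]: "series_shift series_one f = f"
proof
  fix w
  show "series_shift series_one f w = f w"
    by (induction w arbitrary: f) (simp_all add: series_shift_Cons)
qed

text \<open>Strong induction, because the product with \<open>g\<close> involves the shift at all
  suffixes of the tail. The shape \<open>a + s * b\<close> is that of the Leibniz rule.\<close>

lemma series_shift_linear:
  "series_shift g (\<lambda>u. a u + s * b u) w = series_shift g a w + s * series_shift g b w"
proof (induction "length w" arbitrary: a b w rule: less_induct)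
  case less
  show ?case
  proof (cases w)
    case (Cons i w')
    have "series_mult g (series_shift g (\<lambda>u. a (i # u) + s * b (i # u))) w' =
        series_mult g (\<lambda>u. series_shift g (\<lambda>u. a (i # u)) u + s * series_shift g (\<lambda>u. b (i # u)) u) w'"
      using less Cons by (intro series_mult_cong) auto
    then show ?thesis
      by (simp add: Cons series_shift_Cons series_mult_add_right series_mult_scale_right)
  qed simp
qed

text \<open>Both sides have the same constant term and, by induction, the same derivatives: expand
  \<open>\<partial>\<^sub>i (a b)\<close> under \<open>g T\<^sub>g\<close> by the Leibniz rule and
  use that \<open>T\<^sub>g\<close> keeps constant terms.\<close>

lemma series_shift_mult:
  "series_shift g (series_mult a b) = series_mult (series_shift g a) (series_shift g b)"
proof
  fix w
  show "series_shift g (series_mult a b) w = series_mult (series_shift g a) (series_shift g b) w"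
  proof (induction "length w" arbitrary: a b w rule: less_induct)
    case less
    show ?case
    proof (cases w)
      case (Cons i w')
      let ?a = "\<lambda>u. a (i # u)" and ?b = "\<lambda>u. b (i # u)"
      have "series_shift g (series_mult a b) w =
          series_mult g (series_shift g (\<lambda>u. series_mult ?a b u + a [] * ?b u)) w'"
        by (simp add: Cons series_shift_Cons series_mult_Cons)
      also have "\<dots> = series_mult g (\<lambda>u. series_mult (series_shift g ?a) (series_shift g b) u
          + a [] * series_shift g ?b u) w'"
        using less Cons by (intro series_mult_cong) (auto simp: series_shift_linear)
      also have "\<dots> = series_mult (series_mult g (series_shift g ?a)) (series_shift g b) w'
          + a [] * series_mult g (series_shift g ?b) w'"
        by (simp add: series_mult_add_right series_mult_scale_right series_mult_assoc)
      also have "\<dots> = series_mult (series_shift g a) (series_shift g b) w"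
        by (simp add: Cons series_mult_Cons series_shift_Cons)
      finally show ?thesis .
    qed simp
  qed
qed

text \<open>Substituting twice sends \<open>x\<^sub>i\<close> to
  \<open>x\<^sub>i h T\<^sub>h g\<close>, and \<open>h T\<^sub>h g\<close> is
  \<open>shifted_comp g h\<close>. Multiplicativity of \<open>T\<^sub>h\<close> splits this factor
  off each derivative.\<close>

lemma series_shift_shift:
  "series_shift h (series_shift g f) = series_shift (series_mult h (series_shift h g)) f"
proof
  fix w
  show "series_shift h (series_shift g f) w = series_shift (series_mult h (series_shift h g)) f w"
  proof (induction "length w" arbitrary: f w rule: less_induct)
    case less
    show ?case
    proof (cases w)
      case (Cons i w')
      let ?k = "series_mult h (series_shift h g)" and ?f = "\<lambda>u. f (i # u)"
      have "series_shift h (series_shift g f) w =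
          series_mult h (series_shift h (series_mult g (series_shift g ?f))) w'"
        by (simp add: Cons series_shift_Cons)
      also have "\<dots> = series_mult ?k (series_shift h (series_shift g ?f)) w'"
        by (simp add: series_shift_mult series_mult_assoc)
      also have "\<dots> = series_mult ?k (series_shift ?k ?f) w'"
        using less Cons by (intro series_mult_cong) auto
      finally show ?thesis
        by (simp add: Cons series_shift_Cons)
    qed simp
  qed
qed

text \<open>Solves \<open>T\<^sub>g y = h\<close> for \<open>y\<close>: the equation \<open>\<partial>\<^sub>i h = g \<cdot> T\<^sub>g (\<partial>\<^sub>i y)\<close> determines the
  derivatives of \<open>y\<close>.\<close>

primrec series_unshift ::
    "pnat list \<Rightarrow> 'a::{comm_ring, comm_monoid_mult} series \<Rightarrow> 'a series \<Rightarrow> 'a" where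
  "series_unshift [] g h = h []"
| "series_unshift (i # w) g h =
    series_unshift w g (series_mult (series_inverse g) (\<lambda>u. h (i # u)))"

text \<open>If \<open>y\<close> is the solution for \<open>h\<close>, then
  \<open>\<partial>\<^sub>i y\<close> is the solution for
  \<open>g\<^sup>-\<^sup>1 \<partial>\<^sub>i h\<close>, so the induction has to run over all
  \<open>h\<close>.\<close>

lemma series_shift_unshift:
  assumes "g [] = 1"
  shows "series_shift g (\<lambda>w. series_unshift w g h) = h"
proof
  fix w
  show "series_shift g (\<lambda>w. series_unshift w g h) w = h w"
  proof (induction "length w" arbitrary: h w rule: less_induct)
    case less
    show ?case
    proof (cases w)
      case (Cons i w')
      let ?h = "series_mult (series_inverse g) (\<lambda>u. h (i # u))"
      have "series_shift g (\<lambda>w. series_unshift w g h) w =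
          series_mult g (series_shift g (\<lambda>w. series_unshift w g ?h)) w'"
        by (simp add: Cons series_shift_Cons)
      also have "\<dots> = series_mult g ?h w'"
        using less Cons by (intro series_mult_cong) auto
      also have "\<dots> = h w"
        using assms by (simp add: Cons series_mult_inverse flip: series_mult_assoc)
      finally show ?thesis .
    qed simp
  qed
qed

section \<open>The group of series under shifted composition\<close>

text \<open>The left side is \<open>h T\<^sub>h g\<close> times
  \<open>T\<^sub>h T\<^sub>g f\<close>; the first factor is \<open>shifted_comp g h\<close>, which
  is also the subscript of the composite operator.\<close>

lemma shifted_comp_assoc:
  "shifted_comp (shifted_comp f g) h = shifted_comp f (shifted_comp g h)"
  by (simp add: shifted_comp_eq series_shift_mult series_shift_shift series_mult_assoc)

lemma group_series_group: "group (series_group :: 'a::{comm_ring, comm_monoid_mult} series monoid)"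
proof (rule groupI)
  fix g :: "'a series"
  assume "g \<in> carrier series_group"
  then have g: "g [] = 1"
    by (simp add: series_group_def)
  \<comment> \<open>As \<open>shifted_comp y g\<close> is \<open>g T\<^sub>g y\<close>, a left
    inverse has to satisfy \<open>T\<^sub>g y = g\<^sup>-\<^sup>1\<close>.\<close>
  define y where "y = (\<lambda>w. series_unshift w g (series_inverse g))"
  have "shifted_comp y g = series_one" "y [] = 1"
    using g by (simp_all add: y_def shifted_comp_eq series_shift_unshift series_mult_inverse)
  then show "\<exists>y\<in>carrier series_group. y \<otimes>\<^bsub>series_group\<^esub> g = \<one>\<^bsub>series_group\<^esub>"
    by (auto simp: series_group_def)
qed (simp_all add: series_group_def shifted_comp_assoc,
    simp_all add: shifted_comp_eq series_one_def[of "[]"])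


section \<open>Maximal intervals\<close>

lemma max_intervals_subset:
  assumes "J \<in> max_intervals U"
  shows "J \<subseteq> U" "J \<noteq> {}"
  using assms by (simp_all add: max_intervals_def)

lemma max_intervals_interval:
  assumes "U = {a..b}" "U \<noteq> {}"
  shows "max_intervals U = {U}"
proof -
  have "J = U" if "J \<in> max_intervals U" for J
    using that assms(1) unfolding max_intervals_def by blast
  moreover have "U \<in> max_intervals U"
    using assms unfolding max_intervals_def by blast
  ultimately show ?thesis
    by blast
qed

lemma max_intervals_lessThan: "max_intervals {..<n} = (if n = 0 then {} else {{..<n}})"
proof (cases n)
  case (Suc m)
  have "{..<n} = {0..m}"
    using Suc by auto
  then show ?thesis
    using max_intervals_interval[of "{..<n}" 0 m] Suc by simp
qed (auto simp: max_intervals_def)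

text \<open>For an interval \<open>J\<close>, both the inclusion of \<open>J\<close> and its
  maximality concern only intervals that contain \<open>J\<close>.\<close>

lemma max_intervals_cong:
  assumes "\<And>a b. J \<subseteq> {a..b} \<Longrightarrow> {a..b} \<subseteq> U \<longleftrightarrow> {a..b} \<subseteq> V"
  shows "J \<in> max_intervals U \<longleftrightarrow> J \<in> max_intervals V"
proof (cases "\<exists>a b. J = {a..b}")
  case True
  then have "J \<subseteq> U \<longleftrightarrow> J \<subseteq> V"
    using assms by blast
  then show ?thesis
    by (simp add: max_intervals_def assms cong: conj_cong)
qed (auto simp: max_intervals_def)

lemma interval_subset_gap:
  fixes a b k :: nat
  assumes "{a..b} \<subseteq> A \<union> B" "A \<subseteq> {..<k}" "B \<subseteq> {k<..}"
  shows "{a..b} \<subseteq> A \<or> {a..b} \<subseteq> B"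
proof (cases "k \<in> {a..b}")
  case False
  then have "{a..b} \<subseteq> {..<k} \<or> {a..b} \<subseteq> {k<..}"
    by auto
  then show ?thesis
    using assms by fastforce
qed (use assms in fastforce)

text \<open>No interval inside \<open>A \<union> B\<close> crosses the missing point
  \<open>k\<close>, and one that contains a non-empty part of \<open>A\<close> cannot lie in
  \<open>B\<close>.\<close>

lemma max_intervals_Un:
  assumes "A \<subseteq> {..<k}" "B \<subseteq> {k<..}"
  shows "max_intervals (A \<union> B) = max_intervals A \<union> max_intervals B"
proof -
  have disj: "A \<inter> B = {}"
    using assms by fastforce
  have gap: "{a..b} \<subseteq> A \<union> B \<longleftrightarrow> {a..b} \<subseteq> A \<or> {a..b} \<subseteq> B" for a b
    using interval_subset_gap[OF _ assms] by blast
  have A: "J \<in> max_intervals (A \<union> B) \<longleftrightarrow> J \<in> max_intervals A" if "J \<subseteq> A" "J \<noteq> {}" for J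
  proof (rule max_intervals_cong)
    show "{a..b} \<subseteq> A \<union> B \<longleftrightarrow> {a..b} \<subseteq> A" if "J \<subseteq> {a..b}" for a b
    proof -
      have "\<not> {a..b} \<subseteq> B"
        using that \<open>J \<subseteq> A\<close> \<open>J \<noteq> {}\<close> disj by blast
      then show ?thesis
        by (simp add: gap)
    qed
  qed
  have B: "J \<in> max_intervals (A \<union> B) \<longleftrightarrow> J \<in> max_intervals B" if "J \<subseteq> B" "J \<noteq> {}" for J
  proof (rule max_intervals_cong)
    show "{a..b} \<subseteq> A \<union> B \<longleftrightarrow> {a..b} \<subseteq> B" if "J \<subseteq> {a..b}" for a b
    proof -
      have "\<not> {a..b} \<subseteq> A"
        using that \<open>J \<subseteq> B\<close> \<open>J \<noteq> {}\<close> disj by blast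
      then show ?thesis
        by (simp add: gap)
    qed
  qed
  have "J \<subseteq> A \<or> J \<subseteq> B" if J: "J \<in> max_intervals (A \<union> B)" for J
  proof -
    obtain a b where "J = {a..b}" "J \<subseteq> A \<union> B"
      using J unfolding max_intervals_def mem_Collect_eq by metis
    then show ?thesis
      by (simp add: gap)
  qed
  then have "J \<in> max_intervals (A \<union> B) \<longleftrightarrow> J \<in> max_intervals A \<or> J \<in> max_intervals B" for J
    using A B max_intervals_subset by metis
  then show ?thesis
    by (simp add: set_eq_iff)
qed

lemma max_intervals_shift:
  fixes c :: nat
  shows "max_intervals ((+) c ` U) = (`) ((+) c) ` max_intervals U"
proof -
  have inj: "inj ((+) c)"
    by simp
  \<comment> \<open>Translating back by \<open>c\<close> is safe from truncated subtraction: the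
    lower end of a non-empty interval in the image is at least \<open>c\<close>.\<close>
  have down: "\<exists>a' b'. {a..b} = (+) c ` {a'..b'}" if "{a..b} \<subseteq> (+) c ` U" "{a..b} \<noteq> {}" for a b
  proof -
    have "a \<in> (+) c ` U"
      using that by auto
    then have "c \<le> a"
      by auto
    then have "{a..b} = (+) c ` {a - c..b - c}"
      using that(2) by (simp add: image_add_atLeastAtMost)
    then show ?thesis
      by blast
  qed
  have iff: "(+) c ` J \<in> max_intervals ((+) c ` U) \<longleftrightarrow> J \<in> max_intervals U" for J
  proof (cases "J \<noteq> {} \<and> (\<exists>a b. J = {a..b}) \<and> J \<subseteq> U")
    case True
    have "(\<forall>a b. (+) c ` J \<subseteq> {a..b} \<and> {a..b} \<subseteq> (+) c ` U \<longrightarrow> {a..b} = (+) c ` J) \<longleftrightarrow>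
        (\<forall>a b. J \<subseteq> {a..b} \<and> {a..b} \<subseteq> U \<longrightarrow> {a..b} = J)" (is "?L \<longleftrightarrow> ?R")
    proof
      assume ?L
      show ?R
      proof (intro allI impI)
        fix a b
        assume "J \<subseteq> {a..b} \<and> {a..b} \<subseteq> U"
        then have "(+) c ` J \<subseteq> {c + a..c + b} \<and> {c + a..c + b} \<subseteq> (+) c ` U"
          using image_mono[of J "{a..b}" "(+) c"] image_mono[of "{a..b}" U "(+) c"]
          by (simp add: add.commute)
        with \<open>?L\<close> have "{c + a..c + b} = (+) c ` J"
          by blast
        then have "(+) c ` {a..b} = (+) c ` J"
          by (simp add: add.commute)
        then show "{a..b} = J"
          by (simp add: inj_image_eq_iff[OF inj] del: image_add_atLeastAtMost)
      qed
    next
      assume ?R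
      show ?L
      proof (intro allI impI)
        fix a b
        assume *: "(+) c ` J \<subseteq> {a..b} \<and> {a..b} \<subseteq> (+) c ` U"
        then obtain a' b' where "{a..b} = (+) c ` {a'..b'}"
          using down[of a b] True by blast
        moreover from this * have "J \<subseteq> {a'..b'} \<and> {a'..b'} \<subseteq> U"
          by (simp add: inj_image_subset_iff[OF inj] del: image_add_atLeastAtMost)
        then have "{a'..b'} = J"
          using \<open>?R\<close> by blast
        ultimately show "{a..b} = (+) c ` J"
          by (simp only:)
      qed
    qed
    moreover have "\<exists>a b. (+) c ` J = {a..b}" "(+) c ` J \<subseteq> (+) c ` U" "(+) c ` J \<noteq> {}"
      using True by (auto simp: image_add_atLeastAtMost)
    ultimately show ?thesis
      using True unfolding max_intervals_def by simp
  next
    case False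
    have "\<exists>a b. J = {a..b}" if "(+) c ` J = {a..b}" "J \<noteq> {}" "J \<subseteq> U" for a b
      using down[of a b] that inj_image_eq_iff[OF inj] by (metis image_is_empty image_mono)
    with False show ?thesis
      unfolding max_intervals_def by (auto simp: inj_image_subset_iff[OF inj])
  qed
  moreover have "\<exists>J. K = (+) c ` J" if "K \<in> max_intervals ((+) c ` U)" for K
    using that by (auto simp: max_intervals_def subset_image_iff)
  ultimately show ?thesis
    by blast
qed


section \<open>The coefficients of a convolution product\<close>

text \<open>For \<open>g = Lambda_gr \<psi>\<close> and non-empty \<open>w\<close> this is
  \<open>\<psi>\<close> of the right tensor factor that belongs to \<open>S\<close>. As the algebra
  is commutative, a product over the set of intervals replaces the ordered one.\<close>

definition interval_prod ::
    "'a::{comm_ring, comm_monoid_mult} series \<Rightarrow> pnat list \<Rightarrow> nat set \<Rightarrow> 'a" where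
  "interval_prod g w S = (\<Prod>J\<in>max_intervals ({..<length w} - S). g (nths w J))"

definition convolution_coeff ::
    "'a::{comm_ring, comm_monoid_mult} series \<Rightarrow> 'a series \<Rightarrow> 'a series" where
  "convolution_coeff f g w = (\<Sum>S\<in>Pow {..<length w}. f (nths w S) * interval_prod g w S)"

lemma finite_max_intervals [simp]: "finite U \<Longrightarrow> finite (max_intervals U)"
  by (rule finite_subset[of _ "Pow U"]) (auto simp: max_intervals_def)

lemma interval_prod_empty:
  assumes "g [] = 1"
  shows "interval_prod g w {} = g w"
  using assms by (auto simp: interval_prod_def max_intervals_lessThan nths_all)

text \<open>The point \<open>k\<close> separates \<open>{..<k}\<close> from the translated intervals
  of the suffix. For \<open>k = 0\<close> there is no initial interval, and
  \<open>g (take 0 w)\<close> is \<open>1\<close> by \<open>g [] = 1\<close>.\<close>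

lemma interval_prod_split:
  assumes "g [] = 1" "k < length w"
  shows "interval_prod g w (insert k ((+) (Suc k) ` S)) =
    g (take k w) * interval_prod g (drop (Suc k) w) S"
proof -
  let ?n = "length w - Suc k"
  let ?A = "max_intervals {..<k}" and ?B = "max_intervals ((+) (Suc k) ` ({..<?n} - S))"
  have "{..<length w} - insert k ((+) (Suc k) ` S) = {..<k} \<union> (+) (Suc k) ` ({..<?n} - S)"
  proof -
    have "x \<in> (+) (Suc k) ` ({..<?n} - S)"
      if "x < length w" "x \<noteq> k" "x \<notin> (+) (Suc k) ` S" "\<not> x < k" for x
      using that assms(2) by (intro image_eqI[of _ _ "x - Suc k"]) force+
    then show ?thesis
      using assms(2) by auto
  qed
  then have "max_intervals ({..<length w} - insert k ((+) (Suc k) ` S)) = ?A \<union> ?B"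
    using max_intervals_Un[of "{..<k}" k "(+) (Suc k) ` ({..<?n} - S)"] by fastforce
  moreover have "?A \<inter> ?B = {}"
  proof -
    have "J \<noteq> {}" "J \<subseteq> {..<k} \<inter> (+) (Suc k) ` ({..<?n} - S)" if "J \<in> ?A" "J \<in> ?B" for J
      using that max_intervals_subset by blast+
    moreover have "{..<k} \<inter> (+) (Suc k) ` ({..<?n} - S) = {}"
      by auto
    ultimately show ?thesis
      by blast
  qed
  moreover have "(\<Prod>J\<in>?A. g (nths w J)) = g (take k w)"
    using assms by (simp add: max_intervals_lessThan)
  moreover have "(\<Prod>J\<in>?B. g (nths w J)) = interval_prod g (drop (Suc k) w) S"
    unfolding max_intervals_shift interval_prod_def
    by (subst prod.reindex) (auto simp: nths_drop inj_on_def inj_image_eq_iff)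
  ultimately show ?thesis
    by (simp add: interval_prod_def prod.union_disjoint)
qed

lemma nths_insert_shift:
  assumes "k < length w"
  shows "nths w (insert k ((+) (Suc k) ` S)) = w ! k # nths (drop (Suc k) w) S"
proof -
  have *: "w = take k w @ w ! k # drop (Suc k) w"
    using assms by (rule id_take_nth_drop)
  \<comment> \<open>The index set that \<open>nths_append\<close> and \<open>nths_Cons\<close> leave
    for the suffix behind position \<open>k\<close>.\<close>
  have "{j. Suc (j + k) = k \<or> Suc (j + k) \<in> (+) (Suc k) ` S} = S"
    by auto
  moreover have "nths (take k w) (insert k ((+) (Suc k) ` S)) = []"
    by (auto simp: nths_def filter_empty_conv in_set_zip)
  ultimately show ?thesis
    using assms by (subst *) (auto simp: nths_append nths_Cons)
qed

text \<open>A non-empty \<open>S\<close> is determined by its least element \<open>k\<close> and the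
  set of its later elements, recounted from \<open>0\<close>.\<close>

lemma sum_Pow_split_Min:
  fixes n :: nat
  shows "(\<Sum>S\<in>Pow {..<n}. F S) =
    F {} + (\<Sum>k<n. \<Sum>S\<in>Pow {..<n - Suc k}. F (insert k ((+) (Suc k) ` S)))"
proof -
  \<comment> \<open>For \<open>k < n\<close> these are the subsets of \<open>{..<n}\<close> with
    least element \<open>k\<close>.\<close>
  define I where "I k = (\<lambda>S. insert k ((+) (Suc k) ` S)) ` Pow {..<n - Suc k}" for k
  have Min: "(LEAST x. x \<in> T) = k" if "T \<in> I k" for T k
    using that by (auto simp: I_def intro!: Least_equality)
  have cover: "S \<in> (\<Union>k<n. I k)" if "S \<subseteq> {..<n}" "S \<noteq> {}" for S
  proof -
    define k where "k = (LEAST x. x \<in> S)"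
    have k: "k \<in> S" "\<And>x. x \<in> S \<Longrightarrow> k \<le> x"
      using that(2) unfolding k_def by (auto intro: LeastI Least_le)
    have "x \<in> (+) (Suc k) ` {x. Suc k + x \<in> S}" if "x \<in> S" "x \<noteq> k" for x
      using that k(2)[of x] by (intro image_eqI[of _ _ "x - Suc k"]) auto
    then have "S = insert k ((+) (Suc k) ` {x. Suc k + x \<in> S})"
      using k(1) by auto
    moreover have "{x. Suc k + x \<in> S} \<subseteq> {..<n - Suc k}"
      using that(1) by auto
    ultimately have "S \<in> I k"
      unfolding I_def by blast
    then show ?thesis
      using k(1) that(1) by blast
  qed
  have "Pow {..<n} = insert {} (\<Union>k<n. I k)"
    using cover by (auto simp: I_def)
  then have "(\<Sum>S\<in>Pow {..<n}. F S) = F {} + (\<Sum>S\<in>(\<Union>k<n. I k). F S)"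
    by (simp only:) (subst sum.insert, auto simp: I_def)
  also have "(\<Sum>S\<in>(\<Union>k<n. I k). F S) = (\<Sum>k<n. \<Sum>S\<in>I k. F S)"
  proof (rule sum.UNION_disjoint)
    show "\<forall>k\<in>{..<n}. \<forall>l\<in>{..<n}. k \<noteq> l \<longrightarrow> I k \<inter> I l = {}"
      using Min by blast
  qed (auto simp: I_def)
  also have "\<dots> = (\<Sum>k<n. \<Sum>S\<in>Pow {..<n - Suc k}. F (insert k ((+) (Suc k) ` S)))"
  proof (rule sum.cong)
    fix k
    have "inj_on (\<lambda>S. insert k ((+) (Suc k) ` S)) (Pow {..<n - Suc k})"
      by (rule inj_on_inverseI[where g = "\<lambda>T. {x. Suc k + x \<in> T}"]) auto
    then show "(\<Sum>S\<in>I k. F S) = (\<Sum>S\<in>Pow {..<n - Suc k}. F (insert k ((+) (Suc k) ` S)))"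
      by (simp only: I_def sum.reindex comp_def)
  qed simp
  finally show ?thesis .
qed

text \<open>The first term is \<open>S = {}\<close>. If \<open>S\<close> has least element
  \<open>k\<close>, its subword starts with \<open>w ! k\<close>, which turns \<open>f\<close> into
  its derivative.\<close>

lemma convolution_coeff_rec:
  assumes "g [] = 1"
  shows "convolution_coeff f g w = f [] * g w +
    (\<Sum>k<length w. g (take k w) * convolution_coeff (\<lambda>u. f (w ! k # u)) g (drop (Suc k) w))"
proof -
  have "(\<Sum>S\<in>Pow {..<length w - Suc k}. f (nths w (insert k ((+) (Suc k) ` S))) *
      interval_prod g w (insert k ((+) (Suc k) ` S))) =
    g (take k w) * convolution_coeff (\<lambda>u. f (w ! k # u)) g (drop (Suc k) w)"
    if "k < length w" for k
    using assms that
    by (simp only: nths_insert_shift interval_prod_split convolution_coeff_def sum_distrib_left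
        mult.left_commute length_drop)
  then show ?thesis
    using assms
    unfolding convolution_coeff_def[of f]
    by (subst sum_Pow_split_Min) (simp add: interval_prod_empty del: plus_nat.simps)
qed

text \<open>In \<open>g T\<^sub>g f\<close> the cut at the end of \<open>w\<close> gives
  \<open>f [] * g w\<close>. Behind an earlier cut at \<open>k\<close> the suffix starts with
  \<open>w ! k\<close>, and \<open>series_shift_Cons\<close> yields a shifted composition at a
  shorter word, as in \<open>convolution_coeff_rec\<close>.\<close>

lemma convolution_coeff_eq:
  assumes "g [] = 1"
  shows "convolution_coeff f g w = shifted_comp f g w"
proof (induction "length w" arbitrary: f w rule: less_induct)
  case less
  have "shifted_comp f g w = g w * f [] +
      (\<Sum>k<length w. g (take k w) * series_shift g f (drop k w))"
    unfolding shifted_comp_eq series_mult_def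
    by (simp add: add.commute flip: lessThan_Suc_atMost)
  also have "(\<Sum>k<length w. g (take k w) * series_shift g f (drop k w)) =
      (\<Sum>k<length w. g (take k w) * shifted_comp (\<lambda>u. f (w ! k # u)) g (drop (Suc k) w))"
    by (intro sum.cong) (auto simp: shifted_comp_eq series_shift_Cons simp flip: Cons_nth_drop_Suc)
  also have "\<dots> = (\<Sum>k<length w.
      g (take k w) * convolution_coeff (\<lambda>u. f (w ! k # u)) g (drop (Suc k) w))"
    by (intro sum.cong) (simp_all add: less)
  finally show ?case
    by (subst convolution_coeff_rec) (simp_all add: assms mult.commute)
qed


section \<open>Characters\<close>

context comm_unital_algebra
begin

lemma scale_mult_right: "scale c (x * y) = x * scale c y"
  using scale_mult_left[of c y x] by (simp add: mult.commute)

text \<open>The universal property of a monoid algebra, needed for bar words and for pairs of bar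
  words.\<close>

lemma linear_ext_mult:
  fixes h :: "'b::monoid_add \<Rightarrow> 'a"
  assumes "\<And>u v. h (u + v) = h u * h v"
  shows "linear_ext scale h (x * y) = linear_ext scale h x * linear_ext scale h y"
proof -
  interpret L: Vector_Spaces.linear pm_scale scale "linear_ext scale h"
    by (rule linear_linear_ext) (rule vector_space_axioms)
  have *: "linear_ext scale h (Poly_Mapping.single u c * Poly_Mapping.single v d) =
      linear_ext scale h (Poly_Mapping.single u c) * linear_ext scale h (Poly_Mapping.single v d)"
    for u v c d
    by (simp add: mult_single linear_ext_single[OF vector_space_axioms] assms
        scale_left_commute[of c d] flip: scale_mult_left scale_mult_right scale_scale)
  show ?thesis
    by (subst (1 2) pm_expand[of x], subst (1 2) pm_expand[of y])
      (simp add: sum_distrib_left sum_distrib_right L.sum *)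
qed

lemma linear_ext_characters:
  assumes "h 0 = 1" "\<And>u v. h (u + v) = h u * h v"
  shows "linear_ext scale h \<in> characters scale"
proof -
  have "linear_ext scale h 1 = 1"
    using assms(1) by (simp add: linear_ext_single[OF vector_space_axioms] flip: single_one)
  then show ?thesis
    by (simp add: characters_def linear_ext_mult[OF assms(2)]
        linear_linear_ext[OF vector_space_axioms])
qed

lemma linear_eq_linear_ext:
  assumes "Vector_Spaces.linear pm_scale scale \<phi>"
  shows "\<phi> = linear_ext scale (\<lambda>u. \<phi> (Poly_Mapping.single u 1))"
proof
  fix x
  interpret phi: Vector_Spaces.linear pm_scale scale \<phi> by fact
  have "\<phi> (Poly_Mapping.single u c) = scale c (\<phi> (Poly_Mapping.single u 1))" for u c
    using phi.scale[of c "Poly_Mapping.single u 1"] by (simp add: pm_scale_single)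
  then have "linear_ext scale (\<lambda>u. \<phi> (Poly_Mapping.single u 1)) x =
      (\<Sum>u\<in>Poly_Mapping.keys x. \<phi> (Poly_Mapping.single u (Poly_Mapping.lookup x u)))"
    unfolding linear_ext_def by metis
  then show "\<phi> x = linear_ext scale (\<lambda>u. \<phi> (Poly_Mapping.single u 1)) x"
    by (simp only: flip: phi.sum pm_expand)
qed

lemma character_prod_list:
  assumes "\<phi> \<in> characters scale"
  shows "\<phi> (prod_list xs) = prod_list (map \<phi> xs)"
  using assms by (induction xs) (simp_all add: characters_def)

end

section \<open>Characters as free extensions of series\<close>

text \<open>Words generate \<open>T(V)\<close> as an algebra, so a character is determined by its
  values on them.\<close>

lemma single_Bars:
  "Poly_Mapping.single (Bars ws) (1 :: 'k::field) =
    prod_list (map (\<lambda>w. of_word (Rep_nonempty_word w)) ws)"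
proof (induction ws)
  case Nil
  show ?case
    by (simp flip: single_one zero_bar_word_def)
next
  case (Cons w ws)
  have "of_word (Rep_nonempty_word w) = Poly_Mapping.single (Bars [w]) (1 :: 'k)"
    using Rep_nonempty_word[of w] by (simp add: of_word_def Rep_nonempty_word_inverse)
  with Cons show ?case
    by (simp add: mult_single plus_bar_word_def flip: Cons)
qed

context comm_unital_algebra
begin

lemma character_single:
  assumes "\<phi> \<in> characters scale"
  shows "\<phi> (Poly_Mapping.single u 1) =
    prod_list (map (\<lambda>w. Lambda_gr \<phi> (Rep_nonempty_word w)) (blocks u))"
  using single_Bars[of "blocks u", where 'k = 'k] character_prod_list[OF assms]
  by (simp add: Lambda_gr_def comp_def)

lemma Lambda_gr_bij: "bij_betw Lambda_gr (characters scale) (carrier series_group)"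
proof (rule bij_betwI')
  fix \<phi> \<psi>
  assume phi: "\<phi> \<in> characters scale" and psi: "\<psi> \<in> characters scale"
  show "Lambda_gr \<phi> = Lambda_gr \<psi> \<longleftrightarrow> \<phi> = \<psi>"
  proof
    assume "Lambda_gr \<phi> = Lambda_gr \<psi>"
    then have "(\<lambda>u. \<phi> (Poly_Mapping.single u 1)) = (\<lambda>u. \<psi> (Poly_Mapping.single u 1))"
      by (simp add: character_single[OF phi] character_single[OF psi])
    with linear_eq_linear_ext[of \<phi>] linear_eq_linear_ext[of \<psi>] phi psi show "\<phi> = \<psi>"
      by (simp add: characters_def)
  qed simp
next
  fix \<phi>
  assume "\<phi> \<in> characters scale"
  then show "Lambda_gr \<phi> \<in> carrier series_group"
    by (simp add: characters_def Lambda_gr_def series_group_def of_word_def)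
next
  fix f :: "'a series"
  assume "f \<in> carrier series_group"
  then have f: "f [] = 1"
    by (simp add: series_group_def)
  \<comment> \<open>By freeness, the values of \<open>f\<close> on words extend multiplicatively to
    bar words, then linearly.\<close>
  define \<phi> where "\<phi> = linear_ext scale
    (\<lambda>u. prod_list (map (\<lambda>w. f (Rep_nonempty_word w)) (blocks u)))"
  have phi: "\<phi> \<in> characters scale"
    unfolding \<phi>_def by (rule linear_ext_characters) (simp_all add: zero_bar_word_def plus_bar_word_def)
  then have "\<phi> 1 = 1"
    by (simp add: characters_def)
  then have "Lambda_gr \<phi> = f"
    using f by (auto simp: Lambda_gr_def of_word_def fun_eq_iff Abs_nonempty_word_inverse \<phi>_def
        linear_ext_single[OF vector_space_axioms])
  with phi show "\<exists>\<phi>\<in>characters scale. f = Lambda_gr \<phi>"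
    by blast
qed

section \<open>Transport of the group structure\<close>

text \<open>A composite of algebra morphisms; \<open>mult_tensor_map\<close> is multiplicative
  because \<open>A\<close> is commutative.\<close>

lemma convolution_characters:
  assumes "\<phi> \<in> characters scale" "\<psi> \<in> characters scale"
  shows "convolution scale \<phi> \<psi> \<in> characters scale"
proof -
  let ?M = "mult_tensor_map scale \<phi> \<psi>"
  have add: "\<chi> (Poly_Mapping.single (u + v) 1) =
      \<chi> (Poly_Mapping.single u 1) * \<chi> (Poly_Mapping.single v 1)"
    if "\<chi> \<in> characters scale" for \<chi> u v
  proof -
    have "Poly_Mapping.single (u + v) 1 = Poly_Mapping.single u 1 * Poly_Mapping.single v (1 :: 'k)"
      by (simp add: mult_single)
    with that show ?thesis
      by (simp add: characters_def)
  qed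
  have mult: "?M (x * y) = ?M x * ?M y" for x y
    unfolding mult_tensor_map_def
    by (rule linear_ext_mult) (auto simp: add[OF assms(1)] add[OF assms(2)] ac_simps)
  have one: "?M 1 = 1"
    using assms
    by (simp add: mult_tensor_map_def linear_ext_single[OF vector_space_axioms] zero_prod_def
        characters_def flip: single_one)
  have "Vector_Spaces.linear pm_scale scale ?M"
    unfolding mult_tensor_map_def by (rule linear_linear_ext) (rule vector_space_axioms)
  then have "Vector_Spaces.linear pm_scale scale (convolution scale \<phi> \<psi>)"
    unfolding convolution_def by (rule Vector_Spaces.linear_compose[OF coproduct_linear])
  with mult one show ?thesis
    by (simp add: characters_def convolution_def coproduct_one coproduct_mult)
qed

text \<open>The counit extends the indicator of the empty bar word, which is multiplicative: a
  concatenation is empty only if both parts are.\<close>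

lemma counit_characters: "(\<lambda>x. scale (Poly_Mapping.lookup x 0) 1) \<in> characters scale"
proof -
  let ?h = "\<lambda>u :: bar_word. if u = 0 then 1 else 0 :: 'a"
  have "linear_ext scale ?h x = scale (Poly_Mapping.lookup x 0) 1" for x
    by (auto simp: linear_ext_def if_distrib[of "scale _"] in_keys_iff cong: if_cong)
  then have "(\<lambda>x. scale (Poly_Mapping.lookup x 0) 1) = linear_ext scale ?h"
    by (simp add: fun_eq_iff)
  also have "\<dots> \<in> characters scale"
  proof (rule linear_ext_characters)
    show "?h (u + v) = ?h u * ?h v" for u v
      by (cases u; cases v) (auto simp: zero_bar_word_def plus_bar_word_def)
  qed simp
  finally show ?thesis .
qed

lemma Lambda_gr_counit: "Lambda_gr (\<lambda>x. scale (Poly_Mapping.lookup x 0) 1) = series_one"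
  by (auto simp: Lambda_gr_def fun_eq_iff of_word_def series_one_def lookup_one lookup_single
      zero_bar_word_def)

lemma Lambda_gr_convolution:
  assumes "\<phi> \<in> characters scale" "\<psi> \<in> characters scale"
  shows "Lambda_gr (convolution scale \<phi> \<psi>) = shifted_comp (Lambda_gr \<phi>) (Lambda_gr \<psi>)"
proof
  fix w
  have one: "Lambda_gr \<chi> [] = 1" if "\<chi> \<in> characters scale" for \<chi>
    using that by (simp add: Lambda_gr_def of_word_def characters_def)
  show "Lambda_gr (convolution scale \<phi> \<psi>) w = shifted_comp (Lambda_gr \<phi>) (Lambda_gr \<psi>) w"
  proof (cases "w = []")
    case True
    then show ?thesis
      using assms by (simp add: one convolution_characters shifted_comp_eq)
  next
    case False
    have lin: "Vector_Spaces.linear pm_scale scale \<phi>" "Vector_Spaces.linear pm_scale scale \<psi>"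
      using assms by (simp_all add: characters_def)
    interpret M: Vector_Spaces.linear pm_scale scale "mult_tensor_map scale \<phi> \<psi>"
      unfolding mult_tensor_map_def by (rule linear_linear_ext) (rule vector_space_axioms)
    have prod: "\<psi> (prod_list (map (\<lambda>J. of_word (nths w J)) (complement_intervals (length w) S))) =
        interval_prod (Lambda_gr \<psi>) w S" for S
    proof -
      \<comment> \<open>Strictly increasing minima make the list of intervals distinct, so its
        product is the product over the set.\<close>
      have "distinct (complement_intervals (length w) S)"
        using complement_intervals(2)[of "length w" S] by (metis distinct_map strict_sorted_iff)
      then show ?thesis
        by (simp add: character_prod_list[OF assms(2)] comp_def interval_prod_def Lambda_gr_def
            complement_intervals(1) flip: prod.distinct_set_conv_list)
    qed
    have "Lambda_gr (convolution scale \<phi> \<psi>) w = convolution_coeff (Lambda_gr \<phi>) (Lambda_gr \<psi>) w"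
      using False
      by (simp add: Lambda_gr_def convolution_def coproduct_of_word
          coproduct_word_def M.sum mult_tensor_map_tensor[OF comm_unital_algebra_axioms lin] prod
          convolution_coeff_def)
    then show ?thesis
      using one assms(2) by (simp add: convolution_coeff_eq)
  qed
qed

text \<open>Identities are checked after applying the injective \<open>Lambda_gr\<close>; a left
  inverse is the preimage of the one in \<open>series_group\<close>.\<close>

lemma group_character_group: "group (character_group scale)"
proof -
  interpret G: group "series_group :: 'a series monoid"
    by (rule group_series_group)
  let ?C = "character_group scale"
  have inj: "\<phi> = \<psi>" if "\<phi> \<in> characters scale" "\<psi> \<in> characters scale" "Lambda_gr \<phi> = Lambda_gr \<psi>"
    for \<phi> \<psi>
    using Lambda_gr_bij that by (auto simp: bij_betw_def dest: inj_onD)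
  have G: "Lambda_gr \<phi> \<in> carrier series_group" if "\<phi> \<in> characters scale" for \<phi>
    using Lambda_gr_bij that by (auto simp: bij_betw_def)
  have simps: "carrier ?C = characters scale" "mult ?C = convolution scale"
    "one ?C = (\<lambda>x. scale (Poly_Mapping.lookup x 0) 1)"
    "mult series_group = (shifted_comp :: 'a series \<Rightarrow> _)" "one series_group = (series_one :: 'a series)"
    by (simp_all add: character_group_def series_group_def)
  note hom = Lambda_gr_convolution convolution_characters counit_characters Lambda_gr_counit
  show ?thesis
  proof (rule groupI; unfold simps)
    fix \<phi>
    assume phi: "\<phi> \<in> characters scale"
    obtain y where y: "y \<in> carrier series_group" "shifted_comp y (Lambda_gr \<phi>) = series_one"
      using G.l_inv_ex[OF G[OF phi]] by (auto simp: simps)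
    then obtain \<psi> where "\<psi> \<in> characters scale" "Lambda_gr \<psi> = y"
      using Lambda_gr_bij by (force simp: bij_betw_def)
    with y phi show "\<exists>\<psi>\<in>characters scale.
        convolution scale \<psi> \<phi> = (\<lambda>x. scale (Poly_Mapping.lookup x 0) 1)"
      by (intro bexI[of _ \<psi>] inj) (simp_all add: hom)
    show "convolution scale (\<lambda>x. scale (Poly_Mapping.lookup x 0) 1) \<phi> = \<phi>"
      using phi G.l_one[OF G[OF phi]] by (intro inj) (simp_all add: hom simps)
  qed (auto intro!: inj simp: hom shifted_comp_assoc)
qed

end

theorem theorem4p3:
  fixes scale :: "'k::field_char_0 \<Rightarrow> 'a::{comm_ring, comm_monoid_mult} \<Rightarrow> 'a"
  assumes "comm_unital_algebra scale"
  shows "group (character_group scale) \<and> group (series_group :: 'a series monoid) \<and>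
    Lambda_gr \<in> iso (character_group scale) (series_group :: 'a series monoid)"
proof -
  interpret comm_unital_algebra scale by fact
  have "Lambda_gr \<in> hom (character_group scale) (series_group :: 'a series monoid)"
    using Lambda_gr_bij
    by (auto simp: hom_def bij_betw_def character_group_def series_group_def Lambda_gr_convolution)
  then show ?thesis
    using Lambda_gr_bij group_character_group group_series_group
    by (simp add: iso_def character_group_def)
qed

end
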